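(* Let $X$ be a Cantor space, $(X,T)$ a topological dynamical system, and $\mu$ a $T$-invariant Borel probability measure on $X$. If $(X,T)$ is $\mu$-LEP, then $(X,T,\mu)$ has discrete rational spectrum.
   Context: $\mathbb{N}=\{1,2,\dots\}$, $\mathbb{Z}_+=\{0,1,2,\dots\}$. A topological dynamical system (TDS) is a pair $(X,T)$ where $X$ is a compact metric space with metric $d$ and $T:X\to X$ is continuous. Cantor space: $X=\mathcal{A}^{\mathbb{Z}_+}$ with $\mathcal{A}$ a finite set, with the metric $d(x,y)=1/m$ for $x\neq y$, where $m$ is the largest integer such that $x_{W_m}=y_{W_m}$; here $W_m=\{0,1,\dots,m\}$ and $x_W$ is the restriction of $x$ to $W$. (Conventions: $d(x,x)=0$, and $d(x,y)=2$ if $x$ and $y$ do not agree on $W_1$.) Thus for $m\in\mathbb{N}$, $d(x,y)\le 1/m$ if and only if $x_{W_m}=y_{W_m}$. For $m\in\mathbb{N}$, $LEP_m(T)$ is the set of points $x\in X$ for which there exist $p,q\in\mathbb{N}$ with $d(T^ix,T^{i+jp}x)\le 1/m$ for every $i\ge q$ and $j\in\mathbb{Z}_+$. $LEP(T)=\bigcap_{m\in\mathbb{N}}LEP_m(T)$. $(X,T)$ is $\mu$-LEP ($\mu$-locally eventually periodic) if $\mu(LEP(T))=1$. The Koopman operator on $L^2(X,\mu)$ (complex valued) is $U_T:f\mapsto f\circ T$. The spectrum of $(X,T,\mu)$ is discrete if there is an orthonormal basis of $L^2(X,\mu)$ consisting of eigenfunctions of $U_T$; it is rational if the eigenvalues are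 complex roots of unity. *)

theory Defs
  imports "HOL-Probability.Probability"
begin

definition tds :: "'x set \<Rightarrow> ('x \<Rightarrow> 'x \<Rightarrow> real) \<Rightarrow> ('x \<Rightarrow> 'x) \<Rightarrow> bool" where
  "tds X d T \<longleftrightarrow> Metric_space X d \<and> compact_space (Metric_space.mtopology X d) \<and>
     continuous_map (Metric_space.mtopology X d) (Metric_space.mtopology X d) T"

definition borel_measure_of :: "'x topology \<Rightarrow> 'x measure" where
  "borel_measure_of \<tau> = sigma (topspace \<tau>) {U. openin \<tau> U}"

definition invariant_borel_prob ::
    "'x set \<Rightarrow> ('x \<Rightarrow> 'x \<Rightarrow> real) \<Rightarrow> ('x \<Rightarrow> 'x) \<Rightarrow> 'x measure \<Rightarrow> bool" where
  "invariant_borel_prob X d T \<mu> \<longleftrightarrow>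
     prob_space \<mu> \<and> sets \<mu> = sets (borel_measure_of (Metric_space.mtopology X d)) \<and>
     (\<forall>B\<in>sets \<mu>. emeasure \<mu> (T -` B \<inter> space \<mu>) = emeasure \<mu> B)"

definition LEP_at :: "'x set \<Rightarrow> ('x \<Rightarrow> 'x \<Rightarrow> real) \<Rightarrow> ('x \<Rightarrow> 'x) \<Rightarrow> nat \<Rightarrow> 'x set" where
  "LEP_at X d T m = {x \<in> X. \<exists>p\<ge>1. \<exists>q\<ge>1. \<forall>i\<ge>q. \<forall>j.
     d ((T ^^ i) x) ((T ^^ (i + j * p)) x) \<le> 1 / real m}"

definition LEP :: "'x set \<Rightarrow> ('x \<Rightarrow> 'x \<Rightarrow> real) \<Rightarrow> ('x \<Rightarrow> 'x) \<Rightarrow> 'x set" where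
  "LEP X d T = (\<Inter>m\<in>{1..}. LEP_at X d T m)"

definition mu_LEP ::
    "'x set \<Rightarrow> ('x \<Rightarrow> 'x \<Rightarrow> real) \<Rightarrow> ('x \<Rightarrow> 'x) \<Rightarrow> 'x measure \<Rightarrow> bool" where
  "mu_LEP X d T \<mu> \<longleftrightarrow> measure \<mu> (LEP X d T) = 1"

text \<open>
  Elements of the Hilbert space are represented by functions, and equality in it by equality
  almost everywhere.
\<close>

definition L2 :: "'x measure \<Rightarrow> ('x \<Rightarrow> complex) set" where
  "L2 M = {f \<in> borel_measurable M. integrable M (\<lambda>x. (cmod (f x))\<^sup>2)}"

definition L2_inner :: "'x measure \<Rightarrow> ('x \<Rightarrow> complex) \<Rightarrow> ('x \<Rightarrow> complex) \<Rightarrow> complex" where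
  "L2_inner M f g = (LINT x|M. f x * cnj (g x))"

definition L2_norm :: "'x measure \<Rightarrow> ('x \<Rightarrow> complex) \<Rightarrow> real" where
  "L2_norm M f = sqrt (LINT x|M. (cmod (f x))\<^sup>2)"

text \<open>
  Distinct members of an orthonormal basis are orthogonal unit vectors, so no two of them
  represent the same class. The basis may be finite or infinite; its span is dense in norm.
\<close>

definition orthonormal_basis :: "'x measure \<Rightarrow> ('x \<Rightarrow> complex) set \<Rightarrow> bool" where
  "orthonormal_basis M B \<longleftrightarrow> B \<subseteq> L2 M \<and>
     (\<forall>e\<in>B. \<forall>e'\<in>B. L2_inner M e e' = (if e = e' then 1 else 0)) \<and>
     (\<forall>f\<in>L2 M. \<forall>\<epsilon>>0. \<exists>F c. finite F \<and> F \<subseteq> B \<and>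
        L2_norm M (\<lambda>x. f x - (\<Sum>e\<in>F. c e * e x)) < \<epsilon>)"

definition koopman :: "('x \<Rightarrow> 'x) \<Rightarrow> ('x \<Rightarrow> complex) \<Rightarrow> 'x \<Rightarrow> complex" where
  "koopman T f = f \<circ> T"

definition koopman_eigenfunction ::
    "'x measure \<Rightarrow> ('x \<Rightarrow> 'x) \<Rightarrow> complex \<Rightarrow> ('x \<Rightarrow> complex) \<Rightarrow> bool" where
  "koopman_eigenfunction M T c f \<longleftrightarrow> f \<in> L2 M \<and> \<not> (AE x in M. f x = 0) \<and>
     (AE x in M. koopman T f x = c * f x)"

definition discrete_spectrum :: "'x measure \<Rightarrow> ('x \<Rightarrow> 'x) \<Rightarrow> bool" where
  "discrete_spectrum M T \<longleftrightarrow>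
     (\<exists>B. orthonormal_basis M B \<and> (\<forall>e\<in>B. \<exists>c. koopman_eigenfunction M T c e))"

definition rational_spectrum :: "'x measure \<Rightarrow> ('x \<Rightarrow> 'x) \<Rightarrow> bool" where
  "rational_spectrum M T \<longleftrightarrow>
     (\<forall>c. (\<exists>f. koopman_eigenfunction M T c f) \<longrightarrow> (\<exists>n::nat. n \<ge> 1 \<and> c ^ n = 1))"

text \<open>
  The Cantor space over a finite alphabet is the whole function type with domain nat.
  The metric takes the values 0, 2 and 1/m for m at least 1: sequences agreeing at 0 but not
  at 1 have distance 2.
\<close>

definition cantor_dist :: "(nat \<Rightarrow> 'a) \<Rightarrow> (nat \<Rightarrow> 'a) \<Rightarrow> real" where
  "cantor_dist x y =
     (if x = y then 0
      else if \<not> (\<forall>i\<le>1. x i = y i) then 2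
      else 1 / real (GREATEST m. \<forall>i\<le>m. x i = y i))"

lemma cantor_dist_cases:
  fixes x y :: "nat \<Rightarrow> 'a"
  assumes "x \<noteq> y" "\<forall>i\<le>1. x i = y i"
  obtains g where "g \<ge> 1" "cantor_dist x y = 1 / real g"
    "\<And>m. (\<forall>i\<le>m. x i = y i) \<longleftrightarrow> m \<le> g"
proof -
  obtain k where k: "x k \<noteq> y k" using assms(1) by blast
  define P where "P m \<longleftrightarrow> (\<forall>i\<le>m. x i = y i)" for m
  define g where "g = (GREATEST m. P m)"
  have b: "m \<le> k" if "P m" for m
    using k that unfolding P_def by (metis linear)
  have P1: "P 1" unfolding P_def by (rule assms(2))
  have Pg: "P g" unfolding g_def by (rule GreatestI_nat[of P 1 k, OF P1 b])
  have le: "m \<le> g" if "P m" for m unfolding g_def by (rule Greatest_le_nat[of P m k, OF that b])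
  have "P m" if "m \<le> g" for m
    using Pg that unfolding P_def by (metis order_trans)
  with le have iff: "P m \<longleftrightarrow> m \<le> g" for m by blast
  have d: "cantor_dist x y = 1 / real g"
    unfolding cantor_dist_def g_def P_def if_not_P[OF assms(1)] using assms(2) by presburger
  show ?thesis
    by (rule that[OF le[OF P1] d iff[unfolded P_def]])
qed

lemma cantor_dist_le_iff:
  assumes "m \<ge> 1"
  shows "cantor_dist x y \<le> 1 / real m \<longleftrightarrow> (\<forall>i\<le>m. x i = y i)"
proof (cases "x = y \<or> \<not> (\<forall>i\<le>1. x i = y i)")
  case True
  have "1 / real m \<le> 1" using assms by simp
  then have "\<not> 2 \<le> 1 / real m" by linarith
  moreover have "\<not> (\<forall>i\<le>m. x i = y i)" if "\<not> (\<forall>i\<le>1. x i = y i)"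
    using that assms by (meson order_trans)
  moreover have "cantor_dist x y = (if x = y then 0 else 2)"
    using True unfolding cantor_dist_def by presburger
  ultimately show ?thesis using True by (cases "x = y") simp_all
next
  case False
  then have "x \<noteq> y" "\<forall>i\<le>1. x i = y i" by blast+
  then obtain g where "g \<ge> 1" "cantor_dist x y = 1 / real g"
    "\<And>m. (\<forall>i\<le>m. x i = y i) \<longleftrightarrow> m \<le> g" by (rule cantor_dist_cases) blast
  moreover have "1 / real g \<le> 1 / real m \<longleftrightarrow> m \<le> g"
    using assms \<open>g \<ge> 1\<close> by (simp add: field_simps)
  ultimately show ?thesis by simp
qed

lemma cantor_dist_values:
  "cantor_dist x y = 0 \<and> x = y \<or> cantor_dist x y = 2 \<or> (\<exists>m\<ge>1. cantor_dist x y = 1 / real m)"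
proof (cases "x = y \<or> \<not> (\<forall>i\<le>1. x i = y i)")
  case True
  then show ?thesis unfolding cantor_dist_def by presburger
next
  case False
  then have "x \<noteq> y" "\<forall>i\<le>1. x i = y i" by blast+
  then obtain g where "g \<ge> 1" "cantor_dist x y = 1 / real g" by (rule cantor_dist_cases)
  then show ?thesis by blast
qed

lemma cantor_dist_bounds: "0 \<le> cantor_dist x y" "cantor_dist x y \<le> 2"
proof -
  have "\<And>m::nat. m \<ge> 1 \<Longrightarrow> 1 / real m \<le> 2" by (simp add: field_simps)
  then show "0 \<le> cantor_dist x y" "cantor_dist x y \<le> 2"
    using cantor_dist_values[of x y] by auto
qed

lemma cantor_dist_ultra: "cantor_dist x z \<le> max (cantor_dist x y) (cantor_dist y z)"
proof -
  define r where "r = max (cantor_dist x y) (cantor_dist y z)"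
  have r: "cantor_dist x y \<le> r" "cantor_dist y z \<le> r" by (auto simp: r_def)
  have "r = cantor_dist x y \<or> r = cantor_dist y z" by (auto simp: r_def)
  then consider "r = 0" | "r = 2" | m where "m \<ge> 1" "r = 1 / real m"
    using cantor_dist_values[of x y] cantor_dist_values[of y z] by metis
  then have "cantor_dist x z \<le> r"
  proof cases
    case 1
    then have "cantor_dist x y = 0" "cantor_dist y z = 0"
      using r cantor_dist_bounds(1)[of x y] cantor_dist_bounds(1)[of y z] by auto
    then have "x = y" "y = z"
      using cantor_dist_values[of x y] cantor_dist_values[of y z] by auto
    then show ?thesis using r by auto
  next
    case 2 then show ?thesis using cantor_dist_bounds by simp
  next
    case 3
    note iff = cantor_dist_le_iff[OF 3(1), folded 3(2)]
    have "\<forall>i\<le>m. x i = y i" "\<forall>i\<le>m. y i = z i" using r unfolding iff by blast+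
    then show ?thesis unfolding iff by simp
  qed
  then show ?thesis by (simp add: r_def)
qed

lemma Metric_space_cantor: "Metric_space UNIV cantor_dist"
proof
  fix x y z :: "nat \<Rightarrow> 'a"
  show "0 \<le> cantor_dist x y" by (rule cantor_dist_bounds)
  have "(\<lambda>m. \<forall>i\<le>m. x i = y i) = (\<lambda>m. \<forall>i\<le>m. y i = x i)" by (intro ext) metis
  moreover have "(\<forall>i\<le>1. x i = y i) = (\<forall>i\<le>1. y i = x i)" by metis
  ultimately show "cantor_dist x y = cantor_dist y x" unfolding cantor_dist_def by auto
  have "x = y" if "cantor_dist x y = 0"
    using cantor_dist_values[of x y] unfolding that by force
  moreover have "cantor_dist x x = 0" by (simp add: cantor_dist_def)
  ultimately show "cantor_dist x y = 0 \<longleftrightarrow> x = y" by blast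
  show "cantor_dist x z \<le> cantor_dist x y + cantor_dist y z"
    using cantor_dist_ultra[of x z y] cantor_dist_bounds(1)[of x y] cantor_dist_bounds(1)[of y z]
    by linarith
qed

lemma compact_space_cantor:
  "compact_space (Metric_space.mtopology (UNIV :: (nat \<Rightarrow> 'a::finite) set) cantor_dist)"
proof -
  interpret Metric_space "UNIV :: (nat \<Rightarrow> 'a) set" cantor_dist by (rule Metric_space_cantor)
  have small: "\<exists>m\<ge>1. 1 / real m < e" if "e > 0" for e :: real
    using that by (metis One_nat_def Suc_leI inverse_eq_divide real_arch_inverse neq0_conv)
  have "mtotally_bounded UNIV"
    unfolding mtotally_bounded_def
  proof (intro allI impI)
    fix e :: real assume "e > 0"
    then obtain m where m: "m \<ge> 1" "1 / real m < e" using small by blast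
    let ?t = "\<lambda>x i. if i \<le> m then x i else undefined :: 'a"
    let ?K = "range ?t"
    have "?K \<subseteq> PiE {..m} (\<lambda>_. UNIV)" by (auto simp: PiE_def extensional_def)
    then have "finite ?K" by (rule finite_subset) (auto intro: finite_PiE)
    moreover have "x \<in> mball (?t x) e" for x
      using m cantor_dist_le_iff[of m "?t x" x] by auto
    ultimately show "\<exists>K. finite K \<and> K \<subseteq> UNIV \<and> UNIV \<subseteq> (\<Union>x\<in>K. mball x e)"
      by (intro exI[of _ ?K]) blast
  qed
  moreover have "mcomplete"
    unfolding mcomplete_def
  proof (intro allI impI)
    fix s :: "nat \<Rightarrow> nat \<Rightarrow> 'a" assume s: "MCauchy s"
    have "\<exists>N. \<forall>n\<ge>N. \<forall>n'\<ge>N. \<forall>i\<le>m. s n i = s n' i" if "m \<ge> 1" for m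
    proof -
      have "1 / real m > 0" using that by simp
      then obtain N where N: "\<And>n n'. N \<le> n \<Longrightarrow> N \<le> n' \<Longrightarrow> cantor_dist (s n) (s n') < 1 / real m"
        using s unfolding MCauchy_def by blast
      show ?thesis
        using cantor_dist_le_iff[OF that] N[THEN less_imp_le] by blast
    qed
    then have "\<forall>m. \<exists>N. m \<ge> 1 \<longrightarrow> (\<forall>n\<ge>N. \<forall>n'\<ge>N. \<forall>i\<le>m. s n i = s n' i)" by blast
    from choice[OF this] obtain N
      where N: "\<And>m n n' i. m \<ge> 1 \<Longrightarrow> n \<ge> N m \<Longrightarrow> n' \<ge> N m \<Longrightarrow> i \<le> m \<Longrightarrow> s n i = s n' i"
      by blast
    define l where "l i = s (N (Suc i)) i" for i
    have l: "s n i = l i" if "m \<ge> 1" "n \<ge> N m" "i \<le> m" for m n i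
    proof -
      let ?k = "max (N m) (N (Suc i))"
      have "s n i = s ?k i" using N[OF that(1), of n ?k i] that by auto
      also have "\<dots> = l i" unfolding l_def using N[of "Suc i" ?k "N (Suc i)" i] by auto
      finally show ?thesis .
    qed
    have "limitin mtopology s l sequentially"
      unfolding limitin_metric
    proof (intro conjI allI impI)
      fix e :: real assume "e > 0"
      then obtain m where m: "m \<ge> 1" "1 / real m < e" using small by blast
      have "cantor_dist (s n) l < e" if "n \<ge> N m" for n
        using cantor_dist_le_iff[OF m(1), of "s n" l] l[OF m(1) that] m(2) by auto
      then show "\<forall>\<^sub>F n in sequentially. s n \<in> UNIV \<and> cantor_dist (s n) l < e"
        unfolding eventually_sequentially by auto
    qed auto
    then show "\<exists>x. limitin mtopology s x sequentially" by blast
  qed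
  ultimately show ?thesis
    by (simp add: compact_space_eq_mcomplete_mtotally_bounded)
qed

end

theory Submission
  imports Defs
begin

text \<open>
  For a window of length m, the points whose orbit, seen through the window, has period p form a
  forward invariant set E; since E is contained in its preimage and both have the same measure, E
  is invariant up to a null set. Hence an eventually periodic window is almost surely periodic from
  time 0 on, and multiplying the indicator of a cylinder by the indicator of E with p = N!
  gives a function fixed by the N!-th power of the Koopman operator. As N grows
  these functions approximate the cylinder, so the fixed vectors of powers of the Koopman operator
  span a dense subspace. Each of them is a finite sum of eigenvectors whose eigenvalues are roots of
  unity, and Gram--Schmidt turns a countable total family of these into an orthonormal basis. Any
  further eigenvalue would have eigenvectors orthogonal to that family.
\<close>

subsection \<open>Square-integrable functions\<close>

lemma L2_measurable: "f \<in> L2 M \<Longrightarrow> f \<in> borel_measurable M"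
  by (simp add: L2_def)

lemma L2_integrable_square: "f \<in> L2 M \<Longrightarrow> integrable M (\<lambda>x. (cmod (f x))\<^sup>2)"
  by (simp add: L2_def)

text \<open>By the triangle inequality and 2st \<le> s^2 + t^2. It supplies both the integrable
  majorant for sums and the factor 2 in the norm estimate for sums.\<close>

lemma norm_add_square_le: "(norm (a + b))\<^sup>2 \<le> 2 * (norm a)\<^sup>2 + 2 * (norm b)\<^sup>2"
  for a b :: "'a::real_normed_vector"
proof -
  have "(norm (a + b))\<^sup>2 \<le> (norm a + norm b)\<^sup>2"
    by (intro power_mono norm_triangle_ineq) simp
  also have "\<dots> \<le> 2 * (norm a)\<^sup>2 + 2 * (norm b)\<^sup>2"
    using sum_squares_bound[of "norm a" "norm b"] by (simp add: power2_sum)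
  finally show ?thesis .
qed

lemma L2_add:
  assumes "f \<in> L2 M" "g \<in> L2 M"
  shows "(\<lambda>x. f x + g x) \<in> L2 M"
proof -
  have "integrable M (\<lambda>x. (cmod (f x + g x))\<^sup>2)"
  proof (rule Bochner_Integration.integrable_bound)
    show "integrable M (\<lambda>x. 2 * (cmod (f x))\<^sup>2 + 2 * (cmod (g x))\<^sup>2)"
      using assms by (simp add: L2_integrable_square)
    show "(\<lambda>x. (cmod (f x + g x))\<^sup>2) \<in> borel_measurable M"
      using assms[THEN L2_measurable] by measurable
    show "AE x in M. norm ((cmod (f x + g x))\<^sup>2) \<le> norm (2 * (cmod (f x))\<^sup>2 + 2 * (cmod (g x))\<^sup>2)"
      using norm_add_square_le[where 'a = complex] by simp
  qed
  then show ?thesis using assms by (auto simp: L2_def intro: borel_measurable_add)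
qed

lemma L2_scale: "f \<in> L2 M \<Longrightarrow> (\<lambda>x. c * f x) \<in> L2 M"
  unfolding L2_def by (auto simp: norm_mult power_mult_distrib)

lemma L2_diff: "f \<in> L2 M \<Longrightarrow> g \<in> L2 M \<Longrightarrow> (\<lambda>x. f x - g x) \<in> L2 M"
  using L2_add[OF _ L2_scale[of g M "-1"]] by simp

lemma L2_zero: "(\<lambda>x. 0) \<in> L2 M"
  by (simp add: L2_def)

lemma L2_sum: "(\<And>i. i \<in> I \<Longrightarrow> f i \<in> L2 M) \<Longrightarrow> (\<lambda>x. \<Sum>i\<in>I. f i x) \<in> L2 M"
  by (induction I rule: infinite_finite_induct) (simp_all add: L2_zero L2_add)

lemma (in finite_measure) indicator_L2: "A \<in> sets M \<Longrightarrow> indicator A \<in> L2 M"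
  unfolding L2_def
  by (auto intro!: integrable_const_bound[where B = 1] simp: indicator_def)

text \<open>The pointwise bound st \<le> s^2 + t^2 gives an integrable majorant; the full
  Cauchy-Schwarz inequality is avoided.\<close>

lemma L2_inner_integrable:
  assumes "f \<in> L2 M" "g \<in> L2 M"
  shows "integrable M (\<lambda>x. f x * cnj (g x))"
proof (rule Bochner_Integration.integrable_bound)
  show "integrable M (\<lambda>x. (cmod (f x))\<^sup>2 + (cmod (g x))\<^sup>2)"
    using assms by (simp add: L2_integrable_square)
  show "(\<lambda>x. f x * cnj (g x)) \<in> borel_measurable M"
    using assms[THEN L2_measurable] borel_measurable_continuous_onI[OF continuous_on_cnj[OF continuous_on_id]]
    by (intro borel_measurable_times) (auto intro: measurable_compose)
  have "a * b \<le> a\<^sup>2 + b\<^sup>2" for a b :: real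
    using sum_squares_bound[of a b] sum_squares_ge_zero[of a b] unfolding power2_eq_square by linarith
  then show "AE x in M. norm (f x * cnj (g x)) \<le> norm ((cmod (f x))\<^sup>2 + (cmod (g x))\<^sup>2)"
    by (simp add: norm_mult)
qed

lemma L2_inner_scale_left: "L2_inner M (\<lambda>x. c * f x) h = c * L2_inner M f h"
  unfolding L2_inner_def by (simp add: mult.assoc)

lemma L2_inner_commute: "L2_inner M f g = cnj (L2_inner M g f)"
proof -
  have "cnj (L2_inner M g f) = (LINT x|M. cnj (g x * cnj (f x)))"
    unfolding L2_inner_def by (rule Bochner_Integration.integral_cnj[symmetric])
  then show ?thesis unfolding L2_inner_def by (simp add: mult.commute del: Bochner_Integration.integral_cnj)
qed

lemma L2_inner_diff_left:
  "f \<in> L2 M \<Longrightarrow> g \<in> L2 M \<Longrightarrow> h \<in> L2 M \<Longrightarrow>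
    L2_inner M (\<lambda>x. f x - g x) h = L2_inner M f h - L2_inner M g h"
  unfolding L2_inner_def by (simp add: left_diff_distrib L2_inner_integrable)

lemma L2_inner_sum_left:
  assumes "\<And>e. e \<in> F \<Longrightarrow> e \<in> L2 M" "h \<in> L2 M"
  shows "L2_inner M (\<lambda>x. \<Sum>e\<in>F. c e * e x) h = (\<Sum>e\<in>F. c e * L2_inner M e h)"
proof -
  have "L2_inner M (\<lambda>x. \<Sum>e\<in>F. c e * e x) h = (LINT x|M. (\<Sum>e\<in>F. c e * (e x * cnj (h x))))"
    unfolding L2_inner_def by (simp add: sum_distrib_right mult.assoc)
  also have "\<dots> = (\<Sum>e\<in>F. c e * L2_inner M e h)"
    unfolding L2_inner_def
    by (subst Bochner_Integration.integral_sum) (auto intro!: L2_inner_integrable assms)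
  finally show ?thesis .
qed

lemma L2_norm_nonneg: "0 \<le> L2_norm M f"
  by (simp add: L2_norm_def)

lemma L2_norm_square: "(L2_norm M f)\<^sup>2 = (LINT x|M. (cmod (f x))\<^sup>2)"
  by (simp add: L2_norm_def)

lemma L2_inner_self: "L2_inner M f f = of_real ((L2_norm M f)\<^sup>2)"
  unfolding L2_norm_square L2_inner_def
  by (subst integral_complex_of_real[symmetric]) (simp only: complex_norm_square)

lemma L2_norm_eq_0_iff: "f \<in> L2 M \<Longrightarrow> L2_norm M f = 0 \<longleftrightarrow> (AE x in M. f x = 0)"
  unfolding L2_norm_def
  by (simp add: integral_nonneg_eq_0_iff_AE L2_integrable_square)

lemma L2_norm_scale: "L2_norm M (\<lambda>x. c * f x) = cmod c * L2_norm M f"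
  unfolding L2_norm_def by (simp add: norm_mult power_mult_distrib real_sqrt_mult)

text \<open>A quasi-triangle inequality suffices for all density arguments.\<close>

lemma L2_norm_add_le:
  assumes "f \<in> L2 M" "g \<in> L2 M"
  shows "L2_norm M (\<lambda>x. f x + g x) \<le> 2 * (L2_norm M f + L2_norm M g)"
proof (rule power2_le_imp_le)
  have "(L2_norm M (\<lambda>x. f x + g x))\<^sup>2 \<le> (LINT x|M. 2 * (cmod (f x))\<^sup>2 + 2 * (cmod (g x))\<^sup>2)"
    unfolding L2_norm_square using assms
    by (intro integral_mono norm_add_square_le Bochner_Integration.integrable_add
      integrable_mult_right L2_integrable_square L2_add)
  also have "\<dots> = 2 * (L2_norm M f)\<^sup>2 + 2 * (L2_norm M g)\<^sup>2"
    unfolding L2_norm_square using assms by (simp add: L2_integrable_square)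
  also have "\<dots> \<le> (2 * (L2_norm M f + L2_norm M g))\<^sup>2"
    using L2_norm_nonneg[of M f] L2_norm_nonneg[of M g]
    by (simp add: power2_sum power_mult_distrib)
  finally show "(L2_norm M (\<lambda>x. f x + g x))\<^sup>2 \<le> (2 * (L2_norm M f + L2_norm M g))\<^sup>2" .
qed (simp add: L2_norm_nonneg)

text \<open>Pythagoras: the square of the right-hand norm is the sum of the squared norms of
  \<open>f\<close> and \<open>g\<close>.\<close>

lemma L2_norm_diff_ge_orthogonal:
  assumes "f \<in> L2 M" "g \<in> L2 M" "L2_inner M f g = 0"
  shows "L2_norm M f \<le> L2_norm M (\<lambda>x. f x - g x)"
proof (rule power2_le_imp_le)
  let ?h = "\<lambda>x. f x - g x"
  have h: "?h \<in> L2 M" using assms by (intro L2_diff)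
  have gf: "L2_inner M g f = 0" using L2_inner_commute[of M g f] assms(3) by simp
  have 1: "L2_inner M f ?h = L2_inner M f f"
    using L2_inner_commute[of M f ?h] L2_inner_commute[of M f f] assms gf
    by (simp add: L2_inner_diff_left)
  have 2: "L2_inner M g ?h = - L2_inner M g g"
    using L2_inner_commute[of M g ?h] L2_inner_commute[of M g g] assms gf
    by (simp add: L2_inner_diff_left)
  have "L2_inner M ?h ?h = L2_inner M f f + L2_inner M g g"
    using 1 2 L2_inner_diff_left[OF assms(1,2) h] by simp
  then have "(L2_norm M ?h)\<^sup>2 = (L2_norm M f)\<^sup>2 + (L2_norm M g)\<^sup>2"
    unfolding L2_inner_self of_real_add[symmetric] of_real_eq_iff .
  then show "(L2_norm M f)\<^sup>2 \<le> (L2_norm M ?h)\<^sup>2" by simp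
qed (rule L2_norm_nonneg)

subsection \<open>Closed linear spans\<close>

text \<open>The approximation condition is copied from \<open>orthonormal_basis\<close>, so
  completeness of a basis \<open>B\<close> reads
  \<open>L2 M \<subseteq> L2_span_closure M B\<close>. Basis elements serve as their own indices in
  the sums.\<close>

definition L2_span_closure :: "'x measure \<Rightarrow> ('x \<Rightarrow> complex) set \<Rightarrow> ('x \<Rightarrow> complex) set" where
  "L2_span_closure M B = {f \<in> L2 M. \<forall>\<epsilon>>0. \<exists>F c. finite F \<and> F \<subseteq> B \<and>
     L2_norm M (\<lambda>x. f x - (\<Sum>e\<in>F. c e * e x)) < \<epsilon>}"

lemma L2_span_closureD: "f \<in> L2_span_closure M B \<Longrightarrow> f \<in> L2 M"
  by (simp add: L2_span_closure_def)

lemma L2_span_closure_limit: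
  assumes "f \<in> L2 M"
    "\<And>\<epsilon>. \<epsilon> > 0 \<Longrightarrow> \<exists>g\<in>L2_span_closure M B. L2_norm M (\<lambda>x. f x - g x) < \<epsilon>"
    and B: "B \<subseteq> L2 M"
  shows "f \<in> L2_span_closure M B"
  unfolding L2_span_closure_def
proof (intro CollectI conjI allI impI assms(1))
  fix \<epsilon> :: real assume "\<epsilon> > 0"
  \<comment> \<open>Quarters of \<epsilon> absorb the constant 2 in the quasi-triangle inequality:
    2(\<epsilon>/4 + \<epsilon>/4) = \<epsilon>.\<close>
  then obtain g where g: "g \<in> L2_span_closure M B" "L2_norm M (\<lambda>x. f x - g x) < \<epsilon> / 4"
    using assms(2)[of "\<epsilon> / 4"] by auto
  moreover obtain F c where F: "finite F" "F \<subseteq> B"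
      "L2_norm M (\<lambda>x. g x - (\<Sum>e\<in>F. c e * e x)) < \<epsilon> / 4"
    using g(1) \<open>\<epsilon> > 0\<close> unfolding L2_span_closure_def
    by (auto dest!: spec[of _ "\<epsilon> / 4"])
  moreover have "L2_norm M (\<lambda>x. (f x - g x) + (g x - (\<Sum>e\<in>F. c e * e x)))
      \<le> 2 * (L2_norm M (\<lambda>x. f x - g x) + L2_norm M (\<lambda>x. g x - (\<Sum>e\<in>F. c e * e x)))"
    using assms(1) g(1)[THEN L2_span_closureD] F(2) B
    by (intro L2_norm_add_le L2_diff L2_sum L2_scale) auto
  ultimately have "L2_norm M (\<lambda>x. f x - (\<Sum>e\<in>F. c e * e x)) < \<epsilon>" by simp
  then show "\<exists>F c. finite F \<and> F \<subseteq> B \<and> L2_norm M (\<lambda>x. f x - (\<Sum>e\<in>F. c e * e x)) < \<epsilon>"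
    using F by blast
qed

text \<open>Functions only represent classes, so the closure has to be stable under changes on null
  sets; such a change has norm distance 0.\<close>

lemma L2_span_closure_cong_AE:
  assumes "f \<in> L2_span_closure M B" "g \<in> L2 M" "AE x in M. g x = f x" "B \<subseteq> L2 M"
  shows "g \<in> L2_span_closure M B"
proof (rule L2_span_closure_limit[OF assms(2) _ assms(4)])
  fix \<epsilon> :: real assume "\<epsilon> > 0"
  have "L2_norm M (\<lambda>x. g x - f x) = 0"
    using assms(3) by (simp add: L2_norm_eq_0_iff L2_diff assms(2) L2_span_closureD[OF assms(1)])
  then show "\<exists>f\<in>L2_span_closure M B. L2_norm M (\<lambda>x. g x - f x) < \<epsilon>"
    using assms(1) \<open>\<epsilon> > 0\<close> by force
qed

lemma L2_span_closure_zero: "(\<lambda>x. 0) \<in> L2_span_closure M B"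
  unfolding L2_span_closure_def
  by (auto simp: L2_zero intro!: exI[of _ "{}"]) (simp add: L2_norm_def)

lemma L2_span_closure_scale:
  assumes "f \<in> L2_span_closure M B"
  shows "(\<lambda>x. a * f x) \<in> L2_span_closure M B"
  unfolding L2_span_closure_def
proof (intro CollectI conjI allI impI)
  show "(\<lambda>x. a * f x) \<in> L2 M" using assms by (intro L2_scale L2_span_closureD)
  fix \<epsilon> :: real assume "\<epsilon> > 0"
  \<comment> \<open>The added 1 keeps the denominator positive when \<open>a\<close> is 0.\<close>
  then have "\<epsilon> / (cmod a + 1) > 0" by (simp add: add_nonneg_pos)
  then obtain F c where F: "finite F" "F \<subseteq> B"
      "L2_norm M (\<lambda>x. f x - (\<Sum>e\<in>F. c e * e x)) < \<epsilon> / (cmod a + 1)"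
    using assms unfolding L2_span_closure_def by blast
  let ?n = "L2_norm M (\<lambda>x. f x - (\<Sum>e\<in>F. c e * e x))"
  have "(\<lambda>x. a * f x - (\<Sum>e\<in>F. (a * c e) * e x)) = (\<lambda>x. a * (f x - (\<Sum>e\<in>F. c e * e x)))"
    by (simp add: right_diff_distrib sum_distrib_left mult.assoc)
  then have "L2_norm M (\<lambda>x. a * f x - (\<Sum>e\<in>F. (a * c e) * e x)) = cmod a * ?n"
    by (simp only: L2_norm_scale)
  also have "\<dots> \<le> (cmod a + 1) * ?n" using L2_norm_nonneg[of M] by (simp add: distrib_right)
  also have "\<dots> < \<epsilon>" using F(3) by (simp add: pos_less_divide_eq add_nonneg_pos mult.commute)
  finally show "\<exists>F c. finite F \<and> F \<subseteq> B \<and> L2_norm M (\<lambda>x. a * f x - (\<Sum>e\<in>F. c e * e x)) < \<epsilon>"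
    using F(1,2) by (intro exI[of _ F] exI[of _ "\<lambda>e. a * c e"]) simp
qed

lemma L2_span_closure_add:
  assumes f: "f \<in> L2_span_closure M B" and g: "g \<in> L2_span_closure M B" and B: "B \<subseteq> L2 M"
  shows "(\<lambda>x. f x + g x) \<in> L2_span_closure M B"
  unfolding L2_span_closure_def
proof (intro CollectI conjI allI impI)
  show "(\<lambda>x. f x + g x) \<in> L2 M" using f g by (intro L2_add L2_span_closureD)
  fix \<epsilon> :: real assume "\<epsilon> > 0"
  then have e: "\<epsilon> / 4 > 0" by simp
  obtain F c where F: "finite F" "F \<subseteq> B" "L2_norm M (\<lambda>x. f x - (\<Sum>e\<in>F. c e * e x)) < \<epsilon> / 4"
    using f e unfolding L2_span_closure_def by blast
  obtain G d where G: "finite G" "G \<subseteq> B" "L2_norm M (\<lambda>x. g x - (\<Sum>e\<in>G. d e * e x)) < \<epsilon> / 4"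
    using g e unfolding L2_span_closure_def by blast
  \<comment> \<open>The two approximating sums may share basis elements; on the overlap their
    coefficients add up.\<close>
  define b where "b e = (if e \<in> F then c e else 0) + (if e \<in> G then d e else 0)" for e
  have "(\<Sum>e\<in>F \<union> G. b e * e x) = (\<Sum>e\<in>F. c e * e x) + (\<Sum>e\<in>G. d e * e x)" for x
  proof -
    have "(\<Sum>e\<in>F \<union> G. b e * e x) = (\<Sum>e\<in>F \<union> G. (if e \<in> F then c e * e x else 0))
        + (\<Sum>e\<in>F \<union> G. (if e \<in> G then d e * e x else 0))"
      unfolding b_def sum.distrib[symmetric] by (intro sum.cong) (auto simp: distrib_right)
    also have "\<dots> = (\<Sum>e\<in>F. c e * e x) + (\<Sum>e\<in>G. d e * e x)"
      using F(1) G(1) by (simp add: sum.inter_restrict[symmetric] Int_absorb1)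
    finally show ?thesis .
  qed
  then have "(\<lambda>x. f x + g x - (\<Sum>e\<in>F \<union> G. b e * e x)) =
      (\<lambda>x. (f x - (\<Sum>e\<in>F. c e * e x)) + (g x - (\<Sum>e\<in>G. d e * e x)))"
    by (simp add: fun_eq_iff)
  moreover have "L2_norm M (\<lambda>x. (f x - (\<Sum>e\<in>F. c e * e x)) + (g x - (\<Sum>e\<in>G. d e * e x))) \<le>
      2 * (L2_norm M (\<lambda>x. f x - (\<Sum>e\<in>F. c e * e x)) + L2_norm M (\<lambda>x. g x - (\<Sum>e\<in>G. d e * e x)))"
    using f[THEN L2_span_closureD] g[THEN L2_span_closureD] F(2) G(2) B
    by (intro L2_norm_add_le L2_diff L2_sum L2_scale) auto
  ultimately have "L2_norm M (\<lambda>x. f x + g x - (\<Sum>e\<in>F \<union> G. b e * e x)) < \<epsilon>"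
    using F(3) G(3) by simp
  then show "\<exists>F c. finite F \<and> F \<subseteq> B \<and> L2_norm M (\<lambda>x. f x + g x - (\<Sum>e\<in>F. c e * e x)) < \<epsilon>"
    using F(1,2) G(1,2) by (intro exI[of _ "F \<union> G"] exI[of _ b]) simp
qed

lemma L2_span_closure_diff:
  "f \<in> L2_span_closure M B \<Longrightarrow> g \<in> L2_span_closure M B \<Longrightarrow> B \<subseteq> L2 M \<Longrightarrow>
    (\<lambda>x. f x - g x) \<in> L2_span_closure M B"
  using L2_span_closure_add[of f M B "\<lambda>x. - 1 * g x"] L2_span_closure_scale[of g M B "- 1"] by simp

lemma L2_span_closure_sum:
  assumes "B \<subseteq> L2 M" "\<And>i. i \<in> I \<Longrightarrow> f i \<in> L2_span_closure M B"
  shows "(\<lambda>x. \<Sum>i\<in>I. f i x) \<in> L2_span_closure M B"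
  using assms(2)
  by (induction I rule: infinite_finite_induct)
    (simp_all add: L2_span_closure_zero L2_span_closure_add assms(1))

lemma L2_span_closure_base:
  assumes "B \<subseteq> L2 M" "e \<in> B"
  shows "e \<in> L2_span_closure M B"
  unfolding L2_span_closure_def
proof (intro CollectI conjI allI impI)
  show "e \<in> L2 M" using assms by blast
  fix \<epsilon> :: real assume "\<epsilon> > 0"
  then have "L2_norm M (\<lambda>x. e x - (\<Sum>e\<in>{e}. 1 * e x)) < \<epsilon>" by (simp add: L2_norm_def)
  then show "\<exists>F c. finite F \<and> F \<subseteq> B \<and> L2_norm M (\<lambda>x. e x - (\<Sum>e\<in>F. c e * e x)) < \<epsilon>"
    using assms(2) by (intro exI[of _ "{e}"] exI[of _ "\<lambda>_. 1"]) simp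
qed

text \<open>The closure is a closed linear subspace, so it contains finite combinations from
  \<open>D\<close> and their limits.\<close>

lemma L2_span_closure_trans:
  assumes "f \<in> L2_span_closure M D" "D \<subseteq> L2_span_closure M B" "B \<subseteq> L2 M"
  shows "f \<in> L2_span_closure M B"
proof (rule L2_span_closure_limit[OF L2_span_closureD[OF assms(1)] _ assms(3)])
  fix \<epsilon> :: real assume "\<epsilon> > 0"
  then obtain F c where F: "finite F" "F \<subseteq> D" "L2_norm M (\<lambda>x. f x - (\<Sum>e\<in>F. c e * e x)) < \<epsilon>"
    using assms(1) unfolding L2_span_closure_def by blast
  moreover have "(\<lambda>x. \<Sum>e\<in>F. c e * e x) \<in> L2_span_closure M B"
    using F assms by (intro L2_span_closure_sum L2_span_closure_scale) auto
  ultimately show "\<exists>g\<in>L2_span_closure M B. L2_norm M (\<lambda>x. f x - g x) < \<epsilon>" by (intro bexI)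
qed

text \<open>If \<open>f\<close> were orthogonal to all of \<open>B\<close>, Pythagoras would keep
  every finite combination at distance at least the norm of \<open>f\<close>, contradicting an
  approximation with \<epsilon> equal to that norm.\<close>

lemma L2_span_closure_not_orthogonal:
  assumes f: "f \<in> L2_span_closure M B" and B: "B \<subseteq> L2 M" and nz: "\<not> (AE x in M. f x = 0)"
  shows "\<exists>e\<in>B. L2_inner M f e \<noteq> 0"
proof (rule ccontr)
  assume "\<not> ?thesis"
  then have 0: "L2_inner M e f = 0" if "e \<in> B" for e
    using that L2_inner_commute[of M e f] by simp
  have fL: "f \<in> L2 M" by (rule L2_span_closureD[OF f])
  have "L2_norm M f > 0" using nz L2_norm_eq_0_iff[OF fL] L2_norm_nonneg[of M f] by linarith
  then obtain F c where F: "finite F" "F \<subseteq> B"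
      and less: "L2_norm M (\<lambda>x. f x - (\<Sum>e\<in>F. c e * e x)) < L2_norm M f"
    using f unfolding L2_span_closure_def by blast
  let ?g = "\<lambda>x. \<Sum>e\<in>F. c e * e x"
  have "L2_inner M ?g f = (\<Sum>e\<in>F. c e * L2_inner M e f)"
    using F(2) B fL by (intro L2_inner_sum_left) auto
  also have "\<dots> = 0" using F(2) 0 by (intro sum.neutral) auto
  finally have "L2_inner M f ?g = 0" using L2_inner_commute[of M f ?g] by simp
  moreover have "?g \<in> L2 M" using F(2) B by (intro L2_sum L2_scale) auto
  ultimately show False using L2_norm_diff_ge_orthogonal[OF fL, of ?g] less by simp
qed

subsection \<open>Eigenvectors of measure-preserving maps\<close>

text \<open>Invariance is expressed as equality of the push-forward with \<open>M\<close>, so that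
  the library rules for \<open>distr\<close> act as change of variables.\<close>

locale measure_preserving_map = prob_space M for M :: "'x measure" +
  fixes T :: "'x \<Rightarrow> 'x"
  assumes measurable_map [measurable]: "T \<in> measurable M M"
    and distr_map: "distr M M T = M"
begin

lemma measurable_iterate [measurable]: "T ^^ n \<in> measurable M M"
  by (induction n) (auto intro: measurable_comp[OF _ measurable_map] simp: id_def)

lemma distr_iterate: "distr M M (T ^^ n) = M"
proof (induction n)
  case 0
  show ?case by (simp add: id_def distr_id)
next
  case (Suc n)
  have "distr M M (T ^^ Suc n) = distr (distr M M (T ^^ n)) M T"
    by (subst distr_distr) auto
  then show ?case by (simp only: Suc distr_map)
qed

lemma L2_iterate:
  assumes "f \<in> L2 M"
  shows "(\<lambda>x. f ((T ^^ n) x)) \<in> L2 M"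
proof -
  have "integrable (distr M M (T ^^ n)) (\<lambda>x. (cmod (f x))\<^sup>2)"
    using assms by (simp add: distr_iterate L2_integrable_square)
  then have "integrable M (\<lambda>x. (cmod (f ((T ^^ n) x)))\<^sup>2)"
    by (rule integrable_distr[OF measurable_iterate])
  then show ?thesis
    using measurable_compose[OF measurable_iterate L2_measurable[OF assms]] by (simp add: L2_def)
qed

lemma L2_map: "f \<in> L2 M \<Longrightarrow> (\<lambda>x. f (T x)) \<in> L2 M"
  using L2_iterate[of f 1] by simp

lemma L2_inner_map:
  assumes "f \<in> L2 M" "g \<in> L2 M"
  shows "L2_inner M (\<lambda>x. f (T x)) (\<lambda>x. g (T x)) = L2_inner M f g"
proof -
  have "(\<lambda>x. f x * cnj (g x)) \<in> borel_measurable M"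
    using L2_inner_integrable[OF assms] by (rule borel_measurable_integrable)
  from integral_distr[OF measurable_map this] show ?thesis
    by (simp add: L2_inner_def distr_map)
qed

text \<open>Invariance of the inner product under \<open>T\<close> gives <f,g> = c * cnj d * <f,g>,
  and c * cnj d = 1 forces c = d when |d| = 1. The modulus condition concerns \<open>d\<close>
  alone, so \<open>c\<close> may be an eigenvalue about which nothing is known yet.\<close>

lemma eigenvectors_orthogonal:
  assumes "f \<in> L2 M" "g \<in> L2 M"
    and f: "AE x in M. f (T x) = c * f x" and g: "AE x in M. g (T x) = d * g x"
    and d: "cmod d = 1" and "c \<noteq> d"
  shows "L2_inner M f g = 0"
proof -
  have "L2_inner M f g = L2_inner M (\<lambda>x. f (T x)) (\<lambda>x. g (T x))"
    using assms by (simp add: L2_inner_map)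
  also have "\<dots> = (LINT x|M. c * cnj d * (f x * cnj (g x)))"
    unfolding L2_inner_def
  proof (rule integral_cong_AE)
    show "AE x in M. f (T x) * cnj (g (T x)) = c * cnj d * (f x * cnj (g x))"
      using f g by eventually_elim simp
    show "(\<lambda>x. f (T x) * cnj (g (T x))) \<in> borel_measurable M"
      using L2_inner_integrable[OF assms(1,2)[THEN L2_map]] by (rule borel_measurable_integrable)
    show "(\<lambda>x. c * cnj d * (f x * cnj (g x))) \<in> borel_measurable M"
      using L2_inner_integrable[OF assms(1,2)] by simp
  qed
  also have "\<dots> = c * cnj d * L2_inner M f g"
    by (simp add: L2_inner_def)
  finally have "L2_inner M f g = 0 \<or> c * cnj d = 1" by auto
  moreover have "c = d" if "c * cnj d = 1"
  proof -
    have "c = c * (d * cnj d)" using d by (simp add: complex_norm_square[symmetric])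
    also have "\<dots> = c * cnj d * d" by simp
    finally show ?thesis using that by simp
  qed
  ultimately show ?thesis using \<open>c \<noteq> d\<close> by blast
qed

text \<open>Vanishing almost everywhere is allowed, so Fourier components that happen to be zero
  need no separate treatment. Normalisation in Gram--Schmidt excludes them later.\<close>

definition rational_eigenvector :: "('x \<Rightarrow> complex) \<Rightarrow> bool" where
  "rational_eigenvector f \<longleftrightarrow> f \<in> L2 M \<and>
     (\<exists>c n. n \<ge> 1 \<and> c ^ n = 1 \<and> (AE x in M. f (T x) = c * f x))"

lemma rational_eigenvector_L2: "rational_eigenvector f \<Longrightarrow> f \<in> L2 M"
  by (simp add: rational_eigenvector_def)

lemma rational_eigenvector_zero: "rational_eigenvector (\<lambda>x. 0)"
  unfolding rational_eigenvector_def by (intro conjI L2_zero exI[of _ 1]) auto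

lemma norm_root_of_unity: "n \<ge> 1 \<Longrightarrow> c ^ n = 1 \<Longrightarrow> cmod c = 1"
  using power_eq_1_iff[of c n] by simp

definition orthonormal_eigenvectors :: "('x \<Rightarrow> complex) set \<Rightarrow> bool" where
  "orthonormal_eigenvectors F \<longleftrightarrow> (\<forall>e\<in>F. rational_eigenvector e) \<and>
     (\<forall>e\<in>F. \<forall>e'\<in>F. L2_inner M e e' = (if e = e' then 1 else 0))"

text \<open>Gram--Schmidt never leaves the set of eigenvectors, because only members of the same
  eigenspace contribute to the projection.\<close>

lemma gram_schmidt_step:
  assumes "finite F" and F: "orthonormal_eigenvectors F" and u: "rational_eigenvector u"
  obtains F' where "finite F'" "F \<subseteq> F'" "orthonormal_eigenvectors F'" "u \<in> L2_span_closure M F'"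
proof -
  have FL: "F \<subseteq> L2 M" using F by (auto simp: orthonormal_eigenvectors_def rational_eigenvector_def)
  have uL: "u \<in> L2 M" by (rule rational_eigenvector_L2[OF u])
  \<comment> \<open>\<open>p\<close> is the orthogonal projection of \<open>u\<close> onto the span
    of \<open>F\<close>, and \<open>v\<close> below is the remainder.\<close>
  define p where "p x = (\<Sum>e\<in>F. L2_inner M u e * e x)" for x
  define v where "v x = u x - p x" for x
  obtain c n where cn: "n \<ge> 1" "c ^ n = 1" "AE x in M. u (T x) = c * u x"
    using u unfolding rational_eigenvector_def by blast
  have pF: "p \<in> L2_span_closure M F"
    unfolding p_def[abs_def] using FL
    by (intro L2_span_closure_sum L2_span_closure_scale L2_span_closure_base) auto
  have pL: "p \<in> L2 M" by (rule L2_span_closureD[OF pF])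
  have vL: "v \<in> L2 M" unfolding v_def[abs_def] using uL pL by (rule L2_diff)
  have "AE x in M. \<forall>e\<in>F. L2_inner M u e * e (T x) = c * (L2_inner M u e * e x)"
  proof (intro eventually_ball_finite \<open>finite F\<close> ballI)
    fix e assume e: "e \<in> F"
    then obtain d m where d: "m \<ge> 1" "d ^ m = 1" "AE x in M. e (T x) = d * e x"
      using F unfolding orthonormal_eigenvectors_def rational_eigenvector_def by blast
    show "AE x in M. L2_inner M u e * e (T x) = c * (L2_inner M u e * e x)"
    \<comment> \<open>Either \<open>e\<close> lies in the eigenspace of \<open>u\<close>, or it is
      orthogonal to \<open>u\<close> and its term in the projection vanishes.\<close>
    proof (cases "c = d")
      case True
      show ?thesis using d(3) by eventually_elim (simp add: True)
    next
      case False
      have "L2_inner M u e = 0"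
        using e FL by (intro eigenvectors_orthogonal[OF uL _ cn(3) d(3) norm_root_of_unity[OF d(1,2)] False]) auto
      then show ?thesis by simp
    qed
  qed
  then have v_eigen: "AE x in M. v (T x) = c * v x"
    using cn(3)
  proof eventually_elim
    case (elim x)
    have "p (T x) = c * p x" unfolding p_def sum_distrib_left using elim(1) by (intro sum.cong) auto
    then show ?case using elim(2) by (simp add: v_def right_diff_distrib)
  qed
  have v_orth: "L2_inner M v e = 0" if e: "e \<in> F" for e
  proof -
    have "L2_inner M p e = (\<Sum>e'\<in>F. L2_inner M u e' * L2_inner M e' e)"
      unfolding p_def[abs_def] using e FL by (intro L2_inner_sum_left) auto
    also have "\<dots> = (\<Sum>e'\<in>F. if e' = e then L2_inner M u e else 0)"
      using F e by (intro sum.cong) (auto simp: orthonormal_eigenvectors_def)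
    also have "\<dots> = L2_inner M u e" using \<open>finite F\<close> e by simp
    finally show ?thesis
      unfolding v_def[abs_def] using e FL by (subst L2_inner_diff_left[OF uL pL]) auto
  qed
  \<comment> \<open>A null remainder means that \<open>u\<close> is already in the closed span of
    \<open>F\<close>; otherwise the normalised remainder \<open>w\<close> is adjoined and u = p + r
    * w.\<close>
  show thesis
  proof (cases "L2_norm M v = 0")
    case True
    then have "AE x in M. u x = p x" using L2_norm_eq_0_iff[OF vL] by (simp add: v_def)
    then have "u \<in> L2_span_closure M F" by (rule L2_span_closure_cong_AE[OF pF uL _ FL])
    then show ?thesis using \<open>finite F\<close> F by (intro that[of F]) auto
  next
    case False
    define r where "r = complex_of_real (L2_norm M v)"
    have r: "r \<noteq> 0" "cnj r = r" using False by (auto simp: r_def)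
    define w where "w x = (1 / r) * v x" for x
    have wL: "w \<in> L2 M" unfolding w_def[abs_def] using vL by (rule L2_scale)
    have "AE x in M. w (T x) = c * w x" using v_eigen by eventually_elim (simp add: w_def)
    then have w: "rational_eigenvector w" unfolding rational_eigenvector_def using wL cn by blast
    have "L2_norm M w = 1"
      unfolding w_def[abs_def] L2_norm_scale using False L2_norm_nonneg[of M v]
      by (simp add: r_def norm_divide)
    then have ww: "L2_inner M w w = 1" by (simp add: L2_inner_self)
    have wF: "L2_inner M w e = 0" "L2_inner M e w = 0" if "e \<in> F" for e
    proof -
      show "L2_inner M w e = 0" unfolding w_def[abs_def] L2_inner_scale_left v_orth[OF that] by simp
      then show "L2_inner M e w = 0" using L2_inner_commute[of M e w] by simp
    qed
    then have "w \<notin> F" using ww by fastforce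
    then have ok: "orthonormal_eigenvectors (insert w F)"
      using F w ww wF unfolding orthonormal_eigenvectors_def by auto
    have FL': "insert w F \<subseteq> L2 M" using FL wL by blast
    have "(\<lambda>x. p x + r * w x) \<in> L2_span_closure M (insert w F)"
      unfolding p_def[abs_def] using FL'
      by (intro L2_span_closure_add L2_span_closure_sum L2_span_closure_scale L2_span_closure_base) auto
    moreover have "(\<lambda>x. p x + r * w x) = u" using r by (simp add: fun_eq_iff w_def v_def)
    ultimately show ?thesis using \<open>finite F\<close> ok by (intro that[of "insert w F"]) auto
  qed
qed

text \<open>Gram--Schmidt along an enumeration of \<open>G\<close> yields an increasing chain of
  finite orthonormal families, whose union is the basis. For rationality, a nonzero eigenfunction
  cannot be orthogonal to every member of \<open>G\<close>, so it shares its eigenvalue with one of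
  them.\<close>

lemma discrete_rational_spectrum_if_dense:
  assumes "countable G" and G: "\<And>g. g \<in> G \<Longrightarrow> rational_eigenvector g"
    and dense: "L2 M \<subseteq> L2_span_closure M G"
  shows "discrete_spectrum M T \<and> rational_spectrum M T"
proof
  have GL: "G \<subseteq> L2 M" using G rational_eigenvector_L2 by blast
  \<comment> \<open>Adjoining the zero function makes the set nonempty, so that it can be enumerated
    even if \<open>G\<close> is empty.\<close>
  define u where "u = from_nat_into (insert (\<lambda>x. 0) G)"
  have ran: "range u = insert (\<lambda>x. 0) G"
    unfolding u_def using assms(1) by (intro range_from_nat_into) auto
  then have u: "rational_eigenvector (u n)" for n
    using G rational_eigenvector_zero by (metis insertE rangeI)
  define P where "P F \<longleftrightarrow> finite F \<and> orthonormal_eigenvectors F" for F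
  have "\<exists>F. \<forall>n. P (F n) \<and> (F n \<subseteq> F (Suc n) \<and> u n \<in> L2_span_closure M (F (Suc n)))"
  proof (rule dependent_nat_choice)
    show "\<exists>F. P F" by (intro exI[of _ "{}"]) (simp add: P_def orthonormal_eigenvectors_def)
    fix F n assume "P F"
    then show "\<exists>F'. P F' \<and> (F \<subseteq> F' \<and> u n \<in> L2_span_closure M F')"
      unfolding P_def using gram_schmidt_step[OF _ _ u] by metis
  qed
  then obtain F where F: "\<And>n. P (F n)" and F_Suc: "\<And>n. F n \<subseteq> F (Suc n)"
    and uF: "\<And>n. u n \<in> L2_span_closure M (F (Suc n))" by blast
  have mono: "F m \<subseteq> F n" if "m \<le> n" for m n using lift_Suc_mono_le[of F] F_Suc that by blast
  define B where "B = (\<Union>n. F n)"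
  have eig: "rational_eigenvector e" if "e \<in> B" for e
    using that F unfolding B_def P_def orthonormal_eigenvectors_def by blast
  then have BL: "B \<subseteq> L2 M" using rational_eigenvector_L2 by blast
  have orth: "L2_inner M e e' = (if e = e' then 1 else 0)" if e: "e \<in> B" "e' \<in> B" for e e'
  proof -
    \<comment> \<open>Two basis elements from different stages both occur at the later one.\<close>
    obtain m n where "e \<in> F m" "e' \<in> F n" using e unfolding B_def by blast
    then have "e \<in> F (max m n)" "e' \<in> F (max m n)"
      using mono[of m "max m n"] mono[of n "max m n"] by auto
    then show ?thesis using F[of "max m n"] unfolding P_def orthonormal_eigenvectors_def by blast
  qed
  have "G \<subseteq> L2_span_closure M B"
  proof
    fix g assume "g \<in> G"
    then obtain n where "g = u n" using ran by blast
    then have "g \<in> L2_span_closure M (F (Suc n))" using uF by simp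
    moreover have "F (Suc n) \<subseteq> B" by (auto simp: B_def)
    ultimately show "g \<in> L2_span_closure M B"
      using L2_span_closure_base[OF BL] by (meson L2_span_closure_trans BL subset_iff)
  qed
  then have dense_B: "f \<in> L2_span_closure M B" if "f \<in> L2 M" for f
    by (rule L2_span_closure_trans[OF subsetD[OF dense that] _ BL])
  have "orthonormal_basis M B"
    unfolding orthonormal_basis_def using BL orth dense_B by (auto simp: L2_span_closure_def)
  moreover have "\<exists>c. koopman_eigenfunction M T c e" if e: "e \<in> B" for e
  proof -
    have "L2_inner M e e = 1" using orth[OF e e] by simp
    then have "L2_norm M e \<noteq> 0" by (auto simp: L2_inner_self)
    then have "\<not> (AE x in M. e x = 0)" using L2_norm_eq_0_iff e BL by blast
    then show ?thesis
      using eig[OF e] unfolding rational_eigenvector_def koopman_eigenfunction_def koopman_def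
      by auto
  qed
  ultimately show "discrete_spectrum M T" unfolding discrete_spectrum_def by blast
  show "rational_spectrum M T"
    unfolding rational_spectrum_def
  proof (intro allI impI)
    fix c assume "\<exists>f. koopman_eigenfunction M T c f"
    then obtain f where f: "f \<in> L2 M" "\<not> (AE x in M. f x = 0)" "AE x in M. f (T x) = c * f x"
      unfolding koopman_eigenfunction_def koopman_def by auto
    obtain g where g: "g \<in> G" "L2_inner M f g \<noteq> 0"
      using L2_span_closure_not_orthogonal[OF subsetD[OF dense f(1)] GL f(2)] by blast
    obtain d n where d: "n \<ge> 1" "d ^ n = 1" "AE x in M. g (T x) = d * g x"
      using G[OF g(1)] unfolding rational_eigenvector_def by blast
    have "c = d"
      using eigenvectors_orthogonal[OF f(1) subsetD[OF GL g(1)] f(3) d(3) norm_root_of_unity[OF d(1,2)]] g(2)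
      by blast
    then show "\<exists>n\<ge>1. c ^ n = 1" using d by blast
  qed
qed

end

section \<open>Finite Fourier analysis of periodic functions\<close>

lemma primitive_root_of_unity_exists:
  assumes "n \<ge> 1"
  obtains \<omega> :: complex where "\<And>j. \<omega> ^ j = 1 \<longleftrightarrow> n dvd j"
proof
  fix j
  \<comment> \<open>The witness is e^(2 pi i / n).\<close>
  have "exp (2 * of_real pi * \<i> / of_nat n) ^ j = exp (2 * of_real pi * \<i> * of_nat j / of_nat n)"
    by (subst exp_of_nat_mult[symmetric]) (simp add: mult_ac)
  then show "exp (2 * of_real pi * \<i> / of_nat n) ^ j = 1 \<longleftrightarrow> n dvd j"
    using complex_root_unity_eq_1[OF assms] by simp
qed

context measure_preserving_map
begin

text \<open>The components are the discrete Fourier coefficients of the orbit.\<close>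

lemma periodic_decomposition:
  assumes f: "f \<in> L2 M" and n: "n \<ge> 1" and per: "AE x in M. f ((T ^^ n) x) = f x"
  obtains E where "finite E" "\<And>e. e \<in> E \<Longrightarrow> rational_eigenvector e" "f \<in> L2_span_closure M E"
proof -
  obtain \<zeta> :: complex where \<zeta>: "\<And>j. \<zeta> ^ j = 1 \<longleftrightarrow> n dvd j"
    using primitive_root_of_unity_exists[OF n] by metis
  \<comment> \<open>Averaging the orbit with weights \<zeta>^(kj) gives the component of
    \<open>f\<close> with eigenvalue \<zeta>^(-k).\<close>
  define g where "g k x = (\<Sum>j<n. (\<zeta> ^ k) ^ j / of_nat n * f ((T ^^ j) x))" for k x
  have \<zeta>n: "\<zeta> ^ n = 1" using \<zeta> by simp
  then have \<zeta>0: "\<zeta> \<noteq> 0" using n by (auto simp: power_0_left)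
  have g: "rational_eigenvector (g k)" for k
  proof -
    have L: "g k \<in> L2 M" unfolding g_def[abs_def] by (intro L2_sum L2_scale L2_iterate f)
    have root: "(inverse (\<zeta> ^ k)) ^ n = 1"
      using \<zeta>n by (simp add: power_inverse power_mult[symmetric] mult.commute[of k n]) (simp add: power_mult)
    have "AE x in M. g k (T x) = inverse (\<zeta> ^ k) * g k x"
      using per
    proof eventually_elim
      case (elim x)
      define h where "h j = (\<zeta> ^ k) ^ j / of_nat n * f ((T ^^ j) x)" for j
      have "(\<zeta> ^ k) ^ n = 1" using \<zeta>n by (metis mult.commute power_mult power_one)
      then have "h n = h 0" using elim by (simp add: h_def)
      \<comment> \<open>Applying \<open>T\<close> shifts the sum cyclically: the term leaving at 0
        is replaced by the equal term at \<open>n\<close>.\<close>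
      moreover have "(\<Sum>j<n. h (Suc j)) + h 0 = (\<Sum>j<n. h j) + h n"
        by (metis sum.lessThan_Suc sum.lessThan_Suc_shift add.commute)
      ultimately have "(\<Sum>j<n. h (Suc j)) = (\<Sum>j<n. h j)" by simp
      moreover have "\<zeta> ^ k * g k (T x) = (\<Sum>j<n. h (Suc j))"
        unfolding g_def h_def sum_distrib_left by (simp add: funpow_swap1 mult.assoc)
      ultimately have "\<zeta> ^ k * g k (T x) = g k x" by (simp only: g_def h_def)
      then show ?case using \<zeta>0 by (simp add: field_simps)
    qed
    then show ?thesis unfolding rational_eigenvector_def using L n root by blast
  qed
  have f_eq: "f x = (\<Sum>k<n. g k x)" for x
  proof -
    \<comment> \<open>Orthogonality of the characters of Z/n: summing over \<open>k\<close> leaves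
      only the term j = 0, which is \<open>f\<close> itself.\<close>
    have "(\<Sum>k<n. (\<zeta> ^ k) ^ j) = (if j = 0 then of_nat n else 0)" if "j < n" for j
    proof (cases "j = 0")
      case False
      then have "\<zeta> ^ j \<noteq> 1" using \<zeta> that by (auto dest: dvd_imp_le)
      moreover have "(\<zeta> ^ j) ^ n = 1" using \<zeta>n by (metis mult.commute power_mult power_one)
      moreover have "(\<zeta> ^ k) ^ j = (\<zeta> ^ j) ^ k" for k by (metis mult.commute power_mult)
      ultimately show ?thesis using False geometric_sum[of "\<zeta> ^ j" n] by simp
    qed simp
    note sum_root = this
    have "(\<Sum>k<n. g k x) = (\<Sum>j<n. (\<Sum>k<n. (\<zeta> ^ k) ^ j) / of_nat n * f ((T ^^ j) x))"
      unfolding g_def by (subst sum.swap) (simp add: sum_distrib_right sum_divide_distrib)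
    also have "\<dots> = (\<Sum>j<n. if j = 0 then f x else 0)"
      using n by (intro sum.cong) (auto simp: sum_root)
    also have "\<dots> = f x" using n by simp
    finally show ?thesis by simp
  qed
  let ?E = "g ` {..<n}"
  have "(\<lambda>x. \<Sum>k<n. g k x) \<in> L2_span_closure M ?E"
    using g[THEN rational_eigenvector_L2] by (intro L2_span_closure_sum L2_span_closure_base) auto
  then have "f \<in> L2_span_closure M ?E" by (simp only: f_eq[symmetric])
  then show thesis using g by (intro that[of ?E]) auto
qed

text \<open>Each member of \<open>G\<close> is replaced by its finitely many Fourier components; the
  resulting family is still countable and total.\<close>

lemma discrete_rational_spectrum_if_periodic_dense:
  assumes "countable G" and GL: "G \<subseteq> L2 M"
    and per: "\<And>f. f \<in> G \<Longrightarrow> \<exists>n\<ge>1. AE x in M. f ((T ^^ n) x) = f x"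
    and dense: "L2 M \<subseteq> L2_span_closure M G"
  shows "discrete_spectrum M T \<and> rational_spectrum M T"
proof -
  have "\<exists>E. finite E \<and> (\<forall>e\<in>E. rational_eigenvector e) \<and> f \<in> L2_span_closure M E"
    if f: "f \<in> G" for f
  proof -
    obtain n where n: "n \<ge> 1" "AE x in M. f ((T ^^ n) x) = f x" using per[OF f] by auto
    show ?thesis using periodic_decomposition[OF subsetD[OF GL f] n] by metis
  qed
  then obtain E where E: "\<And>f. f \<in> G \<Longrightarrow> finite (E f)"
      "\<And>f e. f \<in> G \<Longrightarrow> e \<in> E f \<Longrightarrow> rational_eigenvector e"
      "\<And>f. f \<in> G \<Longrightarrow> f \<in> L2_span_closure M (E f)"
    by metis
  define D where "D = (\<Union>f\<in>G. E f)"
  have D: "rational_eigenvector e" if "e \<in> D" for e using that E(2) by (auto simp: D_def)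
  then have DL: "D \<subseteq> L2 M" using rational_eigenvector_L2 by auto
  have "f \<in> L2_span_closure M D" if f: "f \<in> G" for f
  proof (rule L2_span_closure_trans[OF E(3)[OF f] _ DL])
    have "E f \<subseteq> D" using f by (auto simp: D_def)
    then show "E f \<subseteq> L2_span_closure M D" using L2_span_closure_base[OF DL] by (meson subset_iff)
  qed
  then have "G \<subseteq> L2_span_closure M D" by auto
  then have "f \<in> L2_span_closure M D" if "f \<in> L2 M" for f
    by (rule L2_span_closure_trans[OF subsetD[OF dense that] _ DL])
  then have dense_D: "L2 M \<subseteq> L2_span_closure M D" by (rule subsetI)
  have "countable D"
    unfolding D_def using assms(1) countable_finite[OF E(1)] by (rule countable_UN)
  then show ?thesis using D dense_D by (rule discrete_rational_spectrum_if_dense)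
qed

end

subsection \<open>Density of a generating family\<close>

text \<open>Dominated convergence: |f - s n| \<le> 3|f|, so 9|f|^2 is an integrable majorant of the
  squared error. The factor 2 in the bound matches the library's approximation by simple
  functions.\<close>

lemma L2_span_closure_dominated_limit:
  assumes B: "B \<subseteq> L2 M" and f: "f \<in> L2 M" and s: "\<And>n. s n \<in> L2_span_closure M B"
    and lim: "AE x in M. (\<lambda>n. s n x) \<longlonglongrightarrow> f x"
    and bound: "\<And>n. AE x in M. cmod (s n x) \<le> 2 * cmod (f x)"
  shows "f \<in> L2_span_closure M B"
proof (rule L2_span_closure_limit[OF f _ B])
  fix \<epsilon> :: real assume "\<epsilon> > 0"
  have diff: "(\<lambda>x. f x - s n x) \<in> L2 M" for n by (intro L2_diff f L2_span_closureD[OF s])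
  have "(\<lambda>n. LINT x|M. (cmod (f x - s n x))\<^sup>2) \<longlonglongrightarrow> (LINT x|M. 0)"
  proof (rule integral_dominated_convergence[where w = "\<lambda>x. 9 * (cmod (f x))\<^sup>2"])
    show "(\<lambda>x. (cmod (f x - s n x))\<^sup>2) \<in> borel_measurable M" for n
      using L2_integrable_square[OF diff] by (rule borel_measurable_integrable)
    show "integrable M (\<lambda>x. 9 * (cmod (f x))\<^sup>2)" using L2_integrable_square[OF f] by simp
    show "AE x in M. (\<lambda>n. (cmod (f x - s n x))\<^sup>2) \<longlonglongrightarrow> 0"
      using lim
    proof eventually_elim
      case (elim x)
      have "(\<lambda>n. (cmod (f x - s n x))\<^sup>2) \<longlonglongrightarrow> (cmod (f x - f x))\<^sup>2"
        by (intro tendsto_intros elim)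
      then show ?case by simp
    qed
    show "AE x in M. norm ((cmod (f x - s n x))\<^sup>2) \<le> 9 * (cmod (f x))\<^sup>2" for n
      using bound[of n]
    proof eventually_elim
      case (elim x)
      have "cmod (f x - s n x) \<le> 3 * cmod (f x)"
        using norm_triangle_ineq4[of "f x" "s n x"] elim by linarith
      then have "(cmod (f x - s n x))\<^sup>2 \<le> (3 * cmod (f x))\<^sup>2" by (intro power_mono) auto
      then show ?case by (simp add: power_mult_distrib)
    qed
  qed auto
  then have "(\<lambda>n. L2_norm M (\<lambda>x. f x - s n x)) \<longlonglongrightarrow> sqrt 0"
    unfolding L2_norm_def by (intro tendsto_real_sqrt) simp
  then have "\<forall>\<^sub>F n in sequentially. L2_norm M (\<lambda>x. f x - s n x) < \<epsilon>"
    using \<open>\<epsilon> > 0\<close> by (intro order_tendstoD) auto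
  then obtain n where "L2_norm M (\<lambda>x. f x - s n x) < \<epsilon>"
    unfolding eventually_sequentially by auto
  then show "\<exists>g\<in>L2_span_closure M B. L2_norm M (\<lambda>x. f x - g x) < \<epsilon>" using s by auto
qed

text \<open>Dynkin's argument: the sets whose indicators lie in the closure are stable under
  complements and countable disjoint unions and contain the intersection-stable generator.\<close>

lemma (in finite_measure) L2_span_closure_indicator_generated:
  assumes B: "B \<subseteq> L2 M" and G: "Int_stable G" "G \<subseteq> Pow (space M)"
    and sets: "sets M = sigma_sets (space M) G" and space: "space M \<in> G"
    and ind: "\<And>C. C \<in> G \<Longrightarrow> indicator C \<in> L2_span_closure M B"
    and A: "A \<in> sets M"
  shows "indicator A \<in> L2_span_closure M B"
  using G A[unfolded sets]
proof (induction rule: sigma_sets_induct_disjoint)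
  case (basic A)
  then show ?case by (rule ind)
next
  case empty
  then show ?case using L2_span_closure_zero by (simp add: indicator_def[abs_def])
next
  case (compl A)
  have "A \<subseteq> space M" by (rule sigma_sets_into_sp[OF G(2) compl(1)])
  then have "indicator (space M - A) = (\<lambda>x. indicator (space M) x - indicator A x :: complex)"
    by (auto simp: fun_eq_iff indicator_def)
  then show ?case using L2_span_closure_diff[OF ind[OF space] compl(2) B] by simp
next
  case (union A)
  have un: "(\<Union>i. A i) \<in> sets M" using union(2) unfolding sets by (auto intro: sigma_sets.Union)
  have eq: "(\<Sum>i<n. indicator (A i) x) = (indicator (\<Union>i<n. A i) x :: complex)" for n x
    using union(1) by (subst indicator_UN_disjoint) (auto intro: disjoint_family_on_mono)
  show ?case
  proof (rule L2_span_closure_dominated_limit[OF B indicator_L2[OF un]])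
    show "(\<lambda>x. \<Sum>i<n. indicator (A i) x) \<in> L2_span_closure M B" for n
      using union(3) by (intro L2_span_closure_sum B)
    show "AE x in M. (\<lambda>n. \<Sum>i<n. indicator (A i) x) \<longlonglongrightarrow> (indicator (\<Union>i. A i) x :: complex)"
      unfolding eq by (intro AE_I2 LIMSEQ_indicator_UN)
    show "AE x in M. cmod (\<Sum>i<n. indicator (A i) x) \<le> 2 * cmod (indicator (\<Union>i. A i) x)" for n
      unfolding eq by (intro AE_I2) (auto simp: indicator_def)
  qed
qed

lemma (in finite_measure) L2_subset_closure_if_generated:
  assumes B: "B \<subseteq> L2 M" and G: "Int_stable G" "G \<subseteq> Pow (space M)"
    and sets: "sets M = sigma_sets (space M) G" and space: "space M \<in> G"
    and ind: "\<And>C. C \<in> G \<Longrightarrow> indicator C \<in> L2_span_closure M B"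
  shows "L2 M \<subseteq> L2_span_closure M B"
proof
  fix f assume f: "f \<in> L2 M"
  obtain s where "(\<forall>i. simple_function M (s i)) \<and> (\<forall>x\<in>space M. (\<lambda>i. s i x) \<longlonglongrightarrow> f x) \<and>
      (\<forall>i. \<forall>x\<in>space M. dist (s i x) 0 \<le> 2 * dist (f x) 0)"
    using borel_measurable_implies_sequence_metric[OF L2_measurable[OF f]] by (rule exE)
  then have s: "\<And>i. simple_function M (s i)" "\<And>x. x \<in> space M \<Longrightarrow> (\<lambda>i. s i x) \<longlonglongrightarrow> f x"
    "\<And>i x. x \<in> space M \<Longrightarrow> cmod (s i x) \<le> 2 * cmod (f x)"
    by simp_all
  \<comment> \<open>\<open>t i\<close> writes the simple function \<open>s i\<close> as a
    combination of indicators; the two agree on the space, which is all that the limit statement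
    sees.\<close>
  define t where "t i x = (\<Sum>y\<in>s i ` space M. y * indicator (s i -` {y} \<inter> space M) x)" for i x
  have t: "t i x = s i x" if x: "x \<in> space M" for i x
  proof -
    have "t i x = (\<Sum>y\<in>s i ` space M. if y = s i x then s i x else 0)"
      unfolding t_def using x by (intro sum.cong) (auto simp: indicator_def)
    also have "\<dots> = s i x" using simple_functionD(1)[OF s(1)[of i]] x by (subst sum.delta) auto
    finally show ?thesis .
  qed
  show "f \<in> L2_span_closure M B"
  proof (rule L2_span_closure_dominated_limit[OF B f])
    show "t i \<in> L2_span_closure M B" for i
      unfolding t_def[abs_def] using s(1)[of i]
      by (intro L2_span_closure_sum B L2_span_closure_scale
          L2_span_closure_indicator_generated[OF assms] simple_functionD) auto
    show "AE x in M. (\<lambda>i. t i x) \<longlonglongrightarrow> f x" using s(2) by (intro AE_I2) (simp add: t)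
    show "AE x in M. cmod (t i x) \<le> 2 * cmod (f x)" for i
      using s(3) by (intro AE_I2) (simp add: t)
  qed
qed

subsection \<open>Cylinder sets\<close>

text \<open>The strict bound makes \<open>cylinder 0 y\<close> the whole space; a window of the
  metric ending at index m corresponds to length m + 1.\<close>

definition cylinder :: "nat \<Rightarrow> (nat \<Rightarrow> 'a) \<Rightarrow> (nat \<Rightarrow> 'a) set" where
  "cylinder m y = {x. \<forall>i<m. x i = y i}"

text \<open>The empty set is included because disjoint cylinders occur and the family must be closed
  under intersection.\<close>

definition cylinders :: "(nat \<Rightarrow> 'a) set set" where
  "cylinders = insert {} (\<Union>m. range (cylinder m))"

lemma finite_range_cylinder: "finite (range (cylinder m :: (nat \<Rightarrow> 'a::finite) \<Rightarrow> _))"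
proof -
  have "cylinder m y \<in> cylinder m ` PiE {..<m} (\<lambda>_. UNIV)" for y :: "nat \<Rightarrow> 'a"
    by (rule image_eqI[of _ _ "restrict y {..<m}"]) (auto simp: cylinder_def)
  then have "range (cylinder m :: (nat \<Rightarrow> 'a) \<Rightarrow> _) \<subseteq> cylinder m ` PiE {..<m} (\<lambda>_. UNIV)" by blast
  then show ?thesis by (rule finite_subset) (intro finite_imageI finite_PiE, auto)
qed

lemma countable_cylinders: "countable (cylinders :: (nat \<Rightarrow> 'a::finite) set set)"
  unfolding cylinders_def by (simp add: countable_finite[OF finite_range_cylinder])

lemma cylinder_in_cylinders: "cylinder m y \<in> cylinders"
  by (auto simp: cylinders_def)

lemma cylinder_self: "x \<in> cylinder m x"
  by (simp add: cylinder_def)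

text \<open>As with ultrametric balls, every point of a cylinder is a centre.\<close>

lemma cylindersE:
  assumes "C \<in> cylinders" "z \<in> C"
  obtains m where "C = cylinder m z"
proof -
  obtain m y where C: "C = cylinder m y" using assms by (auto simp: cylinders_def)
  then have "C = cylinder m z" using assms(2) by (auto simp: cylinder_def)
  then show thesis by (rule that)
qed

text \<open>Two cylinders that meet can be centred at a common point, and then the longer one is the
  intersection.\<close>

lemma Int_stable_cylinders: "Int_stable (cylinders :: (nat \<Rightarrow> 'a) set set)"
proof (rule Int_stableI)
  fix A B :: "(nat \<Rightarrow> 'a) set"
  assume AB: "A \<in> cylinders" "B \<in> cylinders"
  show "A \<inter> B \<in> cylinders"
  proof (cases "A \<inter> B = {}")
    case False
    then obtain z where z: "z \<in> A" "z \<in> B" by blast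
    obtain m where m: "A = cylinder m z" using AB(1) z(1) by (rule cylindersE)
    obtain n where n: "B = cylinder n z" using AB(2) z(2) by (rule cylindersE)
    have "A \<inter> B = cylinder (max m n) z" unfolding m n cylinder_def by (auto simp: less_max_iff_disj)
    then show ?thesis by (simp add: cylinder_in_cylinders)
  qed (simp add: cylinders_def)
qed

lemma openin_cylinder: "openin (Metric_space.mtopology UNIV cantor_dist) (cylinder m y)"
proof -
  interpret Metric_space "UNIV :: (nat \<Rightarrow> 'a) set" cantor_dist by (rule Metric_space_cantor)
  have "mball x (1 / real (Suc m)) \<subseteq> cylinder m y" if "x \<in> cylinder m y" for x :: "nat \<Rightarrow> 'a"
  proof
    fix z assume "z \<in> mball x (1 / real (Suc m))"
    then have "cantor_dist x z \<le> 1 / real (Suc m)" by simp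
    then have "\<forall>i\<le>Suc m. x i = z i" by (subst (asm) cantor_dist_le_iff) auto
    then show "z \<in> cylinder m y" using that by (simp add: cylinder_def)
  qed
  then show ?thesis unfolding openin_mtopology by (force intro: exI[of _ "1 / real (Suc m)"])
qed

lemma open_eq_Union_cylinders:
  assumes "openin (Metric_space.mtopology UNIV cantor_dist) U"
  shows "U = \<Union>{C \<in> cylinders. C \<subseteq> U}"
proof -
  interpret Metric_space "UNIV :: (nat \<Rightarrow> 'a) set" cantor_dist by (rule Metric_space_cantor)
  have "\<exists>C\<in>cylinders. C \<subseteq> U \<and> x \<in> C" if x: "x \<in> U" for x
  proof -
    obtain r where r: "r > 0" "mball x r \<subseteq> U" using assms x unfolding openin_mtopology by blast
    obtain n where n: "1 / real (Suc n) < r" using r(1) nat_approx_posE by blast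
    \<comment> \<open>Length n + 2 fixes the coordinates 0 to n + 1, which means distance at most
      1/(n + 1).\<close>
    have "cylinder (Suc (Suc n)) x \<subseteq> mball x r"
    proof
      fix z assume "z \<in> cylinder (Suc (Suc n)) x"
      then have "cantor_dist x z \<le> 1 / real (Suc n)"
        by (subst cantor_dist_le_iff) (auto simp: cylinder_def)
      then show "z \<in> mball x r" using n by simp
    qed
    with r(2) have "cylinder (Suc (Suc n)) x \<subseteq> U" by simp
    then show ?thesis by (metis cylinder_in_cylinders cylinder_self)
  qed
  then show ?thesis by blast
qed

lemma sets_borel_cantor:
  "sets (borel_measure_of (Metric_space.mtopology (UNIV :: (nat \<Rightarrow> 'a::finite) set) cantor_dist))
     = sigma_sets UNIV cylinders"
proof -
  interpret Metric_space "UNIV :: (nat \<Rightarrow> 'a) set" cantor_dist by (rule Metric_space_cantor)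
  have "sigma_sets UNIV {U. openin mtopology U} = sigma_sets UNIV (cylinders :: (nat \<Rightarrow> 'a) set set)"
  proof (rule sigma_sets_eqI)
    fix U assume "U \<in> {U. openin mtopology U}"
    then have "U = \<Union>{C \<in> cylinders. C \<subseteq> U}" using open_eq_Union_cylinders by blast
    \<comment> \<open>Finiteness of the alphabet enters here: there are only countably many
      cylinders, so the union is countable.\<close>
    moreover have "\<Union>{C \<in> cylinders. C \<subseteq> U} \<in> sigma_sets UNIV cylinders"
      by (rule sigma_sets_UNION)
        (auto intro: countable_subset[OF _ countable_cylinders])
    ultimately show "U \<in> sigma_sets UNIV cylinders" by simp
  next
    fix C :: "(nat \<Rightarrow> 'a) set" assume "C \<in> cylinders"
    then show "C \<in> sigma_sets UNIV {U. openin mtopology U}"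
      by (auto simp: cylinders_def openin_cylinder)
  qed
  then show ?thesis by (simp add: borel_measure_of_def)
qed

subsection \<open>Locally eventually periodic points\<close>

text \<open>A forward invariant set is contained in its preimage under the iterate, and both have
  the same finite measure, so their difference is null.\<close>

lemma (in measure_preserving_map) AE_iterate_mem_iff:
  assumes A: "A \<in> sets M" and inv: "\<And>x. x \<in> A \<Longrightarrow> T x \<in> A"
  shows "AE x in M. (T ^^ n) x \<in> A \<longleftrightarrow> x \<in> A"
proof -
  let ?B = "(T ^^ n) -` A \<inter> space M"
  have inv_n: "(T ^^ n) x \<in> A" if "x \<in> A" for x using that inv by (induction n) auto
  have B: "?B \<in> sets M" using A by measurable
  have AB: "A \<subseteq> ?B" using inv_n sets.sets_into_space[OF A] by blast
  have "measure M ?B = measure M A"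
    using measure_distr[OF measurable_iterate A, of n] by (simp add: distr_iterate)
  then have "measure M (?B - A) = 0" using finite_measure_Diff[OF B A AB] by simp
  then have "?B - A \<in> null_sets M" using A B by (intro null_setsI) (auto simp: emeasure_eq_measure)
  from AE_not_in[OF this] show ?thesis
    using AE_space by eventually_elim (use inv_n in blast)
qed

text \<open>The period condition starts at time 0, not eventually. For p = 0 it holds trivially, so
  p \<ge> 1 is carried along where it matters.\<close>

definition window_periodic :: "((nat \<Rightarrow> 'a) \<Rightarrow> nat \<Rightarrow> 'a) \<Rightarrow> nat \<Rightarrow> nat \<Rightarrow> (nat \<Rightarrow> 'a) set" where
  "window_periodic T m p = {x. \<forall>k. \<forall>i<m. (T ^^ (k + p)) x i = (T ^^ k) x i}"

lemma window_periodic_map: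
  assumes "x \<in> window_periodic T m p"
  shows "T x \<in> window_periodic T m p"
proof -
  have "(T ^^ j) (T x) = (T ^^ Suc j) x" for j by (simp add: funpow_swap1)
  moreover have "(T ^^ (Suc k + p)) x i = (T ^^ Suc k) x i" if "i < m" for k i
    using assms that unfolding window_periodic_def by blast
  ultimately show ?thesis unfolding window_periodic_def by simp
qed

text \<open>Repeating the period gives every multiple. Hence a point of period p has period N! for
  all N \<ge> p.\<close>

lemma window_periodic_dvd:
  assumes "x \<in> window_periodic T m p" "p dvd n"
  shows "x \<in> window_periodic T m n"
proof -
  have "(T ^^ (k + l * p)) x i = (T ^^ k) x i" if "i < m" for k l i
  proof (induction l)
    case (Suc l)
    have "(T ^^ (k + l * p + p)) x i = (T ^^ (k + l * p)) x i"
      using assms(1) that unfolding window_periodic_def by blast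
    then show ?case using Suc by (simp add: algebra_simps)
  qed simp
  then show ?thesis using assms(2) unfolding window_periodic_def dvd_def by (auto simp: mult.commute)
qed

lemma LEP_window_periodic:
  assumes "x \<in> LEP UNIV cantor_dist T"
  shows "\<exists>p q. p \<ge> 1 \<and> (T ^^ q) x \<in> window_periodic T m p"
proof -
  \<comment> \<open>\<open>Suc m\<close> is at least 1, as the characterisation of the metric
    requires, and its window contains all coordinates below \<open>m\<close>.\<close>
  have "x \<in> LEP_at UNIV cantor_dist T (Suc m)" using assms unfolding LEP_def by auto
  then obtain p q where p: "p \<ge> 1"
    and *: "\<And>i j. i \<ge> q \<Longrightarrow> cantor_dist ((T ^^ i) x) ((T ^^ (i + j * p)) x) \<le> 1 / real (Suc m)"
    unfolding LEP_at_def by blast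
  have "(T ^^ (k + p)) ((T ^^ q) x) i = (T ^^ k) ((T ^^ q) x) i" if "i < m" for k i
  proof -
    have "\<forall>i\<le>Suc m. (T ^^ (k + q)) x i = (T ^^ (k + q + 1 * p)) x i"
      using cantor_dist_le_iff[THEN iffD1, OF _ *[of "k + q" 1]] by simp
    then have "(T ^^ (k + p + q)) x i = (T ^^ (k + q)) x i" using that by (simp add: add_ac)
    then show ?thesis by (simp add: funpow_add)
  qed
  then show ?thesis using p unfolding window_periodic_def by blast
qed

section \<open>Periodic approximation of cylinders in a \<open>\<mu>\<close>-LEP system\<close>

theorem theorem27:
  fixes T :: "(nat \<Rightarrow> 'a::finite) \<Rightarrow> (nat \<Rightarrow> 'a)"
    and \<mu> :: "(nat \<Rightarrow> 'a) measure"
  assumes "tds UNIV cantor_dist T"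
    and "invariant_borel_prob UNIV cantor_dist T \<mu>"
    and "mu_LEP UNIV cantor_dist T \<mu>"
  shows "discrete_spectrum \<mu> T \<and> rational_spectrum \<mu> T"
proof -
  have "prob_space \<mu>" and sets: "sets \<mu> = sigma_sets UNIV cylinders"
    and inv: "\<And>B. B \<in> sets \<mu> \<Longrightarrow> emeasure \<mu> (T -` B \<inter> space \<mu>) = emeasure \<mu> B"
    using assms(2) unfolding invariant_borel_prob_def sets_borel_cantor by blast+
  have sp: "space \<mu> = UNIV"
    using sets_eq_imp_space_eq[of \<mu> "sigma UNIV cylinders"] sets by simp
  have cyl: "C \<in> sets \<mu>" if "C \<in> cylinders" for C using that by (simp add: sets)
  have opn: "U \<in> sets \<mu>" if "openin (Metric_space.mtopology UNIV cantor_dist) U" for U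
    using assms(2) that Metric_space.topspace_mtopology[OF Metric_space_cantor]
    unfolding invariant_borel_prob_def borel_measure_of_def by auto
  have "T -` C \<in> sets \<mu>" if "C \<in> cylinders" for C
  proof -
    have "openin (Metric_space.mtopology UNIV cantor_dist) C"
      using that by (auto simp: cylinders_def openin_cylinder)
    moreover have "continuous_map (Metric_space.mtopology UNIV cantor_dist)
        (Metric_space.mtopology UNIV cantor_dist) T" using assms(1) by (simp add: tds_def)
    ultimately have "openin (Metric_space.mtopology UNIV cantor_dist)
        {x \<in> topspace (Metric_space.mtopology UNIV cantor_dist). T x \<in> C}"
      by (metis openin_continuous_map_preimage)
    then have "{x. T x \<in> C} \<in> sets \<mu>"
      using opn by (simp add: Metric_space.topspace_mtopology[OF Metric_space_cantor])
    then show ?thesis by (simp add: vimage_def)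
  qed
  then have T: "T \<in> measurable \<mu> \<mu>"
    by (intro measurable_sigma_sets[OF sets]) (auto simp: sp)
  have "distr \<mu> \<mu> T = \<mu>"
    by (rule measure_eqI) (simp_all add: emeasure_distr[OF T] inv)
  with \<open>prob_space \<mu>\<close> T interpret measure_preserving_map \<mu> T
    by (simp add: measure_preserving_map_def measure_preserving_map_axioms_def)
  have coord: "(\<lambda>x. x i) \<in> measurable \<mu> (count_space UNIV)" for i
  proof (rule measurable_count_space_eq2_countable[THEN iffD2], intro conjI ballI)
    fix a :: 'a
    \<comment> \<open>Fixing one coordinate leaves finitely many choices for the earlier ones, hence
      a finite union of cylinders.\<close>
    have "(\<lambda>x. x i) -` {a} = \<Union> (cylinder (Suc i) ` {x. x i = a})"
    proof (intro equalityI subsetI)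
      fix x assume "x \<in> (\<lambda>x. x i) -` {a}"
      then show "x \<in> \<Union> (cylinder (Suc i) ` {x. x i = a})" using cylinder_self by auto
    qed (auto simp: cylinder_def)
    moreover have "\<Union> (cylinder (Suc i) ` {x. x i = a}) \<in> sets \<mu>"
    proof (rule sets.finite_Union)
      show "finite (cylinder (Suc i) ` {x :: nat \<Rightarrow> 'a. x i = a})"
        by (rule finite_subset[OF _ finite_range_cylinder]) auto
    qed (auto intro!: cyl cylinder_in_cylinders)
    ultimately show "(\<lambda>x. x i) -` {a} \<inter> space \<mu> \<in> sets \<mu>" by (simp add: sp)
  qed auto
  have E: "window_periodic T m p \<in> sets \<mu>" for m p
  proof -
    have [measurable]: "(\<lambda>x. (T ^^ k) x i) \<in> measurable \<mu> (count_space UNIV)" for k i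
      by (rule measurable_compose[OF measurable_iterate coord])
    have "{x \<in> space \<mu>. \<forall>k. \<forall>i\<in>{..<m}. (T ^^ (k + p)) x i = (T ^^ k) x i} \<in> sets \<mu>"
      by measurable
    then show ?thesis by (simp add: sp window_periodic_def Ball_def)
  qed
  have E_iff: "AE x in \<mu>. (T ^^ n) x \<in> window_periodic T m p \<longleftrightarrow> x \<in> window_periodic T m p" for n m p
    by (rule AE_iterate_mem_iff[OF E window_periodic_map])
  \<comment> \<open>Measurability comes from the hypothesis itself: \<open>measure\<close> has the
    default value 0 outside the \<sigma>-algebra, and here it is 1.\<close>
  have "LEP UNIV cantor_dist T \<in> sets \<mu>"
    using assms(3) unfolding mu_LEP_def by (metis measure_notin_sets zero_neq_one)
  then have LEP: "AE x in \<mu>. x \<in> LEP UNIV cantor_dist T"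
    using assms(3) unfolding mu_LEP_def by (simp add: prob_eq_1)
  have periodic: "AE x in \<mu>. \<exists>p\<ge>1. x \<in> window_periodic T m p" for m
  proof -
    \<comment> \<open>Some iterate of almost every point is window periodic; the equivalence, taken
      over countably many \<open>n\<close> and \<open>p\<close>, carries this back to the point
      itself.\<close>
    have "AE x in \<mu>. \<forall>n p. (T ^^ n) x \<in> window_periodic T m p \<longleftrightarrow> x \<in> window_periodic T m p"
      using E_iff by (simp add: AE_all_countable)
    with LEP show ?thesis by eventually_elim (use LEP_window_periodic in blast)
  qed
  \<comment> \<open>Factorials make the periodic sets increase with \<open>N\<close> and exhaust
    almost all points. The length \<open>m\<close> is recorded separately because a cylinder as a
    set need not determine it.\<close>
  define g :: "(nat \<Rightarrow> 'a) set \<times> nat \<times> nat \<Rightarrow> (nat \<Rightarrow> 'a) \<Rightarrow> complex"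
    where "g = (\<lambda>(C, m, N). indicator (C \<inter> window_periodic T m (fact N)))"
  define I :: "((nat \<Rightarrow> 'a) set \<times> nat \<times> nat) set"
    where "I = (\<Union>m. range (cylinder m) \<times> {m} \<times> (UNIV :: nat set))"
  have gL: "g ` I \<subseteq> L2 \<mu>"
    using cyl E by (auto simp: g_def I_def cylinders_def intro!: indicator_L2 sets.Int)
  show ?thesis
  proof (rule discrete_rational_spectrum_if_periodic_dense)
    have "countable I"
      unfolding I_def
      by (intro countable_UN countable_SIGMA countable_finite[OF finite_range_cylinder]) auto
    then show "countable (g ` I)" by (rule countable_image)
    show "g ` I \<subseteq> L2 \<mu>" by (rule gL)
    fix f assume "f \<in> g ` I"
    then obtain m y N where f: "f = indicator (cylinder m y \<inter> window_periodic T m (fact N))"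
      by (auto simp: g_def I_def)
    \<comment> \<open>On the periodic set the first \<open>m\<close> coordinates recur after N!
      steps, so membership in the cylinder is unchanged; off it both values are 0 almost
      surely.\<close>
    have "AE x in \<mu>. f ((T ^^ fact N) x) = f x"
      using E_iff[of "fact N" m "fact N"]
    proof eventually_elim
      case (elim x)
      have "(T ^^ fact N) x \<in> cylinder m y \<longleftrightarrow> x \<in> cylinder m y" if "x \<in> window_periodic T m (fact N)"
      proof -
        have "(T ^^ (0 + fact N)) x i = (T ^^ 0) x i" if "i < m" for i
          using \<open>x \<in> window_periodic T m (fact N)\<close> that unfolding window_periodic_def by blast
        then show ?thesis by (simp add: cylinder_def)
      qed
      then show ?case using elim unfolding f indicator_def by auto
    qed
    then show "\<exists>n\<ge>1. AE x in \<mu>. f ((T ^^ n) x) = f x"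
      by (intro exI[of _ "fact N"]) (auto simp: fact_ge_1)
  next
    show "L2 \<mu> \<subseteq> L2_span_closure \<mu> (g ` I)"
    proof (rule L2_subset_closure_if_generated[OF gL Int_stable_cylinders])
      show "space \<mu> \<in> cylinders"
        by (auto simp: sp cylinders_def cylinder_def intro!: exI[of _ "0::nat"])
      fix C :: "(nat \<Rightarrow> 'a) set" assume C: "C \<in> cylinders"
      show "indicator C \<in> L2_span_closure \<mu> (g ` I)"
      proof (cases "C = {}")
        case True
        then show ?thesis using L2_span_closure_zero by (simp add: indicator_def[abs_def])
      next
        case False
        then obtain m where m: "C \<in> range (cylinder m)" using C by (auto simp: cylinders_def)
        show ?thesis
        proof (rule L2_span_closure_dominated_limit[OF gL indicator_L2[OF cyl[OF C]]])
          show "g (C, m, N) \<in> L2_span_closure \<mu> (g ` I)" for N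
            using m by (intro L2_span_closure_base[OF gL]) (auto simp: I_def)
          show "AE x in \<mu>. (\<lambda>N. g (C, m, N) x) \<longlonglongrightarrow> indicator C x"
            using periodic[of m]
          proof eventually_elim
            case (elim x)
            then obtain p where p: "p \<ge> 1" "x \<in> window_periodic T m p" by blast
            \<comment> \<open>The sequence is eventually constant, since \<open>p\<close> divides N!
              once N \<ge> p.\<close>
            have "g (C, m, N) x = indicator C x" if "N \<ge> p" for N
              using window_periodic_dvd[OF p(2) dvd_fact[OF p(1) that]]
              by (simp add: g_def indicator_def)
            then show ?case
              by (intro tendsto_eventually) (auto simp: eventually_sequentially)
          qed
          show "AE x in \<mu>. cmod (g (C, m, N) x) \<le> 2 * cmod (indicator C x)" for N
            by (intro AE_I2) (auto simp: g_def indicator_def)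
        qed
      qed
    qed (simp_all add: sp sets)
  qed
qed

end
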